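(* Let $H$ be a graph with at least one edge. Then: (i) if $H$ contains a pendant edge and $n>f(H)+1$, then $\mathrm{rwsat}(n, H)\leq \binom{f(H)+1}{2}$; (ii) if $H$ contains no pendant edges and $n>f(H)+\delta'(H)$, then $$\frac{1}{2}\delta'(H)n \leq\mathrm{rwsat}(n, H)\leq \delta'(H)\bigl(n-f(H)-\delta'(H)\bigr)+\binom{f(H)+\delta'(H)}{2}.$$
   Context: All graphs are finite and simple. An edge is pendant if one of its endpoints has degree $1$. $\delta'(H)=\min\{d_H(v)\colon v\in V(H),\ d_H(v)\neq 0\}$. For a family $\mathscr{F}$ of graphs, $\mathrm{ex}(N,\mathscr{F})$ is the maximum number of edges in an $N$-vertex graph containing no member of $\mathscr{F}$ as a subgraph. For a graph $H$, let $\mathscr{H}=\{H-\{x,y\}\colon xy\in E(H)\}$ (deleting the two vertices $x,y$), and let $f(H)$ be the smallest integer $n$ such that for each $N\in\{n-1,n\}$ we have $\mathrm{ex}(N,\mathscr{H})\leq \binom{N}{2}-2N-2$. An edge-coloring of $G$ is a map $c\colon E(G)\to\mathbb{N}$; a subgraph is rainbow if its edges have pairwise distinct colors. An edge-colored graph $G$ is weakly $H$-rainbow saturated if there exists an ordering $e_1,\dots,e_m$ of the non-edges of $G$ such that for every list $c_1,\dots,c_m$ of pairwise distinct colors from $\mathbb{N}$ (possibly coinciding with colors used on $G$), for every $i\in[m]$ the edge-colored graph obtained from $G$ by adding $e_1,\dots,e_i$ with $e_k$ colored $c_k$ contains a rainbow copy of $H$ containing $e_i$ ($G$ need not be rainbow-$H$-free).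 $\mathrm{rwsat}(n,H)$ is the minimum number of edges of such a graph on $n$ vertices (defined as $\binom n2$ if none exists). *)

theory Defs
  imports Complex_Main "HOL-Library.Extended_Real"
begin

section \<open>Finite simple graphs\<close>

type_synonym 'a graph = "'a set \<times> 'a set set"

abbreviation verts :: "'a graph \<Rightarrow> 'a set" where "verts \<equiv> fst"
abbreviation edges :: "'a graph \<Rightarrow> 'a set set" where "edges \<equiv> snd"

definition all_pairs :: "'a set \<Rightarrow> 'a set set" where
  "all_pairs V = {e. e \<subseteq> V \<and> card e = 2}"

definition simple_graph :: "'a graph \<Rightarrow> bool" where
  "simple_graph G \<longleftrightarrow> finite (verts G) \<and> edges G \<subseteq> all_pairs (verts G)"

definition non_edges :: "'a graph \<Rightarrow> 'a set set" where
  "non_edges G = all_pairs (verts G) - edges G"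

definition vdegree :: "'a graph \<Rightarrow> 'a \<Rightarrow> nat" where
  "vdegree G v = card {e \<in> edges G. v \<in> e}"

definition pendant_edge :: "'a graph \<Rightarrow> 'a set \<Rightarrow> bool" where
  "pendant_edge G e \<longleftrightarrow> e \<in> edges G \<and> (\<exists>v\<in>e. vdegree G v = 1)"

text \<open>The parameter \<open>\<delta>'\<close>; meaningful only for graphs with at least one edge.\<close>

definition min_nonzero_degree :: "'a graph \<Rightarrow> nat" where
  "min_nonzero_degree G = Min {vdegree G v | v. v \<in> verts G \<and> vdegree G v \<noteq> 0}"

definition delete_verts :: "'a graph \<Rightarrow> 'a set \<Rightarrow> 'a graph" where
  "delete_verts G S = (verts G - S, {e \<in> edges G. e \<inter> S = {}})"

text \<open>A copy of \<open>H\<close> in \<open>G\<close> is a not necessarily induced subgraph of \<open>G\<close> isomorphic to \<open>H\<close>; it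
  is given by an embedding \<open>\<phi>\<close>, and its edge set is \<open>(`) \<phi> ` edges H\<close>. Isolated vertices of \<open>H\<close>
  have to be embedded as well.\<close>

definition embedding :: "('a \<Rightarrow> 'b) \<Rightarrow> 'a graph \<Rightarrow> 'b graph \<Rightarrow> bool" where
  "embedding \<phi> H G \<longleftrightarrow>
     inj_on \<phi> (verts H) \<and> \<phi> ` verts H \<subseteq> verts G \<and> (`) \<phi> ` edges H \<subseteq> edges G"

definition contains_copy :: "'b graph \<Rightarrow> 'a graph \<Rightarrow> bool" where
  "contains_copy G H \<longleftrightarrow> (\<exists>\<phi>. embedding \<phi> H G)"


section \<open>Extremal numbers and the parameter \<open>f(H)\<close>\<close>

text \<open>Graphs on \<open>N\<close> vertices are taken, up to isomorphism, with vertices in \<^typ>\<open>nat\<close>.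
  The supremum ranges over a finite set of numbers, so it is a maximum whenever some
  \<open>N\<close>-vertex graph avoids the family; if none does, the maximum over the empty set is \<open>-\<infinity>\<close>.
  This gives the smallest possible \<open>f(H)\<close>.\<close>

definition extremal_number :: "nat \<Rightarrow> 'a graph set \<Rightarrow> ereal" where
  "extremal_number N \<F> =
     (SUP G \<in> {G :: nat graph. simple_graph G \<and> card (verts G) = N \<and>
                              (\<forall>F\<in>\<F>. \<not> contains_copy G F)}.
        ereal (real (card (edges G))))"

definition edge_deletion_family :: "'a graph \<Rightarrow> 'a graph set" where
  "edge_deletion_family H = {delete_verts H {x, y} | x y. {x, y} \<in> edges H}"

text \<open>The bound \<open>n \<ge> 1\<close> makes \<open>n - 1\<close> a genuine number of vertices (no truncation).\<close>

definition threshold :: "'a graph \<Rightarrow> nat" where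
  "threshold H =
     (LEAST n. n \<ge> 1 \<and>
        (\<forall>N\<in>{n - 1, n}. extremal_number N (edge_deletion_family H)
                          \<le> ereal (real (N choose 2) - 2 * real N - 2)))"


section \<open>Weak rainbow saturation\<close>

text \<open>An edge-coloring is a total function on vertex sets; only its values on the edges of the
  graph under consideration matter.\<close>

definition rainbow_copy_through ::
    "'a graph \<Rightarrow> 'b graph \<Rightarrow> ('b set \<Rightarrow> nat) \<Rightarrow> 'b set \<Rightarrow> bool" where
  "rainbow_copy_through H G c e \<longleftrightarrow>
     (\<exists>\<phi>. embedding \<phi> H G \<and> e \<in> (`) \<phi> ` edges H \<and> inj_on c ((`) \<phi> ` edges H))"

definition add_edges :: "'b graph \<Rightarrow> 'b set list \<Rightarrow> 'b graph" where
  "add_edges G es = (verts G, edges G \<union> set es)"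

definition extend_coloring ::
    "('b set \<Rightarrow> nat) \<Rightarrow> 'b set list \<Rightarrow> nat list \<Rightarrow> 'b set \<Rightarrow> nat" where
  "extend_coloring c es cs e = (case map_of (zip es cs) e of None \<Rightarrow> c e | Some k \<Rightarrow> k)"

definition weakly_rainbow_saturated ::
    "'a graph \<Rightarrow> 'b graph \<Rightarrow> ('b set \<Rightarrow> nat) \<Rightarrow> bool" where
  "weakly_rainbow_saturated H G c \<longleftrightarrow>
     (\<exists>es. distinct es \<and> set es = non_edges G \<and>
        (\<forall>cs. length cs = length es \<and> distinct cs \<longrightarrow>
           (\<forall>i<length es.
              rainbow_copy_through H (add_edges G (take (Suc i) es))
                (extend_coloring c (take (Suc i) es) (take (Suc i) cs)) (es ! i))))"

definition rwsat :: "nat \<Rightarrow> 'a graph \<Rightarrow> nat" where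
  "rwsat n H =
     (let S = {card (edges G) | (G :: nat graph) c.
                 simple_graph G \<and> card (verts G) = n \<and> weakly_rainbow_saturated H G c}
      in if S = {} then n choose 2 else (LEAST k. k \<in> S))"

end

theory Submission
  imports Defs
begin

text \<open>Write \<open>f = threshold H\<close> and let \<open>w\<close> be a vertex of \<open>H\<close> of degree \<open>d = \<delta>'(H)\<close>. For the upper
  bounds take a rainbow clique \<open>K\<close> on \<open>f + d\<close> vertices and join every other vertex to a fixed set
  \<open>D \<subseteq> K\<close> of size \<open>d\<close> (to nothing when \<open>d = 1\<close>), with all colours distinct. First add the missing
  edges between the outside and \<open>K\<close>: the outside vertex plays the role of \<open>w\<close>, and the rest of \<open>H\<close>
  fits into \<open>K\<close> with a spare vertex, which is used to dodge the only possible colour conflict.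
  Then every outside vertex sees \<open>K - D\<close> in pairwise distinct new colours. An edge \<open>{v, v'}\<close> added
  between outside vertices together with the edges from \<open>v\<close> and \<open>v'\<close> to \<open>f\<close> vertices of \<open>K - D\<close>
  spoils at most \<open>2 f + 1\<close> edges among these vertices, so by the choice of \<open>f\<close> the remaining ones
  contain some \<open>H - {x, y}\<close>, which \<open>v\<close> and \<open>v'\<close> complete to \<open>H\<close>. For the lower bound, in a saturated
  graph every degree is at least \<open>d\<close>.\<close>

section \<open>Pairs, degrees and extensions of injections\<close>

lemma all_pairs_iff: "e \<in> all_pairs V \<longleftrightarrow> (\<exists>x\<in>V. \<exists>y\<in>V. x \<noteq> y \<and> e = {x, y})"
  unfolding all_pairs_def by (auto simp: card_2_iff)

lemma doubleton_in_all_pairs [simp]: "{x, y} \<in> all_pairs V \<longleftrightarrow> x \<in> V \<and> y \<in> V \<and> x \<noteq> y"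
  by (auto simp: all_pairs_def card_insert_if)

lemma all_pairs_mono: "A \<subseteq> B \<Longrightarrow> all_pairs A \<subseteq> all_pairs B"
  by (auto simp: all_pairs_def)

lemma finite_all_pairs: "finite V \<Longrightarrow> finite (all_pairs V)"
  unfolding all_pairs_def by (rule finite_subset[of _ "Pow V"]) auto

lemma card_all_pairs: "finite V \<Longrightarrow> card (all_pairs V) = card V choose 2"
  unfolding all_pairs_def by (rule n_subsets)

lemma simple_graph_finite_edges: "simple_graph G \<Longrightarrow> finite (edges G)"
  unfolding simple_graph_def using finite_all_pairs finite_subset by blast

lemma simple_graph_edgeE:
  assumes "simple_graph G" "e \<in> edges G"
  obtains x y where "x \<in> verts G" "y \<in> verts G" "x \<noteq> y" "e = {x, y}"
  using assms unfolding simple_graph_def by (metis all_pairs_iff subsetD)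

lemma vdegree_eq_card_neighbours:
  assumes "simple_graph G"
  shows "vdegree G v = card {x. {v, x} \<in> edges G}"
proof -
  have "bij_betw (\<lambda>x. {v, x}) {x. {v, x} \<in> edges G} {e \<in> edges G. v \<in> e}"
  proof (rule bij_betw_imageI)
    show "inj_on (\<lambda>x. {v, x}) {x. {v, x} \<in> edges G}"
      by (auto simp: inj_on_def doubleton_eq_iff)
    show "(\<lambda>x. {v, x}) ` {x. {v, x} \<in> edges G} = {e \<in> edges G. v \<in> e}"
    proof safe
      fix e assume e: "e \<in> edges G" "v \<in> e"
      obtain x y where "e = {x, y}" using simple_graph_edgeE[OF assms e(1)] by metis
      then show "e \<in> (\<lambda>x. {v, x}) ` {x. {v, x} \<in> edges G}"
        using e by (auto simp: insert_commute)
    qed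
  qed
  then show ?thesis unfolding vdegree_def by (simp add: bij_betw_same_card)
qed

lemma sum_vdegree:
  assumes "simple_graph G"
  shows "(\<Sum>v\<in>verts G. vdegree G v) = 2 * card (edges G)"
proof -
  have fin: "finite (verts G)" "finite (edges G)"
    using assms simple_graph_finite_edges[OF assms] by (simp_all add: simple_graph_def)
  have "\<forall>e\<in>edges G. card {v \<in> verts G. v \<in> e} = 2"
  proof
    fix e assume "e \<in> edges G"
    then have "e \<subseteq> verts G" "card e = 2"
      using assms by (auto simp: simple_graph_def all_pairs_def)
    moreover from this(1) have "{v \<in> verts G. v \<in> e} = e" by auto
    ultimately show "card {v \<in> verts G. v \<in> e} = 2" by simp
  qed
  from sum_multicount[OF fin this] show ?thesis unfolding vdegree_def by simp
qed

lemma card_delete_two: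
  assumes "simple_graph H" "{x, y} \<in> edges H"
  shows "card (verts (delete_verts H {x, y})) = card (verts H) - 2"
proof -
  have "{x, y} \<subseteq> verts H" "card {x, y} = 2"
    using assms by (auto simp: simple_graph_def all_pairs_def)
  then show ?thesis unfolding delete_verts_def fst_conv by (metis card_Diff_subset finite.intros)
qed

lemma ex_inj_extension:
  assumes "finite B" "finite C" "card B \<le> card C" "A \<subseteq> B" "inj_on f A" "f ` A \<subseteq> C"
  shows "\<exists>g. inj_on g B \<and> g ` B \<subseteq> C \<and> (\<forall>a\<in>A. g a = f a)"
proof -
  have "finite A" using assms finite_subset by blast
  then have "card (B - A) \<le> card (C - f ` A)"
    using assms by (simp add: card_Diff_subset card_image)
  then obtain h where h: "inj_on h (B - A)" "h ` (B - A) \<subseteq> C - f ` A"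
    using card_le_inj[of "B - A" "C - f ` A"] assms by auto
  let ?g = "\<lambda>a. if a \<in> A then f a else h a"
  have "inj_on ?g B"
  proof (rule inj_onI)
    fix a b assume ab: "a \<in> B" "b \<in> B" "?g a = ?g b"
    have *: "f x \<noteq> h y" if "x \<in> A" "y \<in> B - A" for x y using h(2) that by blast
    show "a = b"
      using ab *[of a b] *[of b a] inj_onD[OF assms(5), of a b] inj_onD[OF h(1), of a b]
      by (cases "a \<in> A"; cases "b \<in> A") auto
  qed
  moreover have "?g ` B \<subseteq> C" using h assms by auto
  ultimately show ?thesis by (intro exI[of _ ?g]) auto
qed

section \<open>The parameter \<open>f(H)\<close>\<close>

text \<open>A vertex of minimum degree together with a large independent set among its non-neighbours
  gives the next independent set; passing to the non-neighbours at most doubles the density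
  constant \<open>C\<close>.\<close>

lemma sparse_graph_independent_set:
  "\<exists>N0. \<forall>(V :: 'b set) M. finite V \<and> N0 \<le> card V \<and> M \<subseteq> all_pairs V \<and> card M \<le> C * card V
      \<longrightarrow> (\<exists>S\<subseteq>V. card S = m \<and> all_pairs S \<inter> M = {})"
proof (induction m arbitrary: C)
  case 0
  show ?case by (intro exI[of _ 0] allI impI exI[of _ "{}"]) (auto simp: all_pairs_iff)
next
  case (Suc m)
  obtain N0 where N0: "\<And>(V :: 'b set) M. finite V \<Longrightarrow> N0 \<le> card V \<Longrightarrow> M \<subseteq> all_pairs V \<Longrightarrow>
      card M \<le> 2 * C * card V \<Longrightarrow> \<exists>S\<subseteq>V. card S = m \<and> all_pairs S \<inter> M = {}"
    using Suc.IH[of "2 * C"] by metis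
  show ?case
  \<comment> \<open>At most 2C + 1 vertices will be deleted. The summand 4C + 2 makes
    \<open>V\<close> nonempty and keeps at least half of its vertices, which is what doubles the
    density constant; \<open>N0\<close> vertices remain for the induction hypothesis.\<close>
  proof (intro exI[of _ "N0 + 4 * C + 2"] allI impI, elim conjE)
    fix V :: "'b set" and M
    assume V: "finite V" "N0 + 4 * C + 2 \<le> card V" and M: "M \<subseteq> all_pairs V" "card M \<le> C * card V"
    have G: "simple_graph (V, M)" using V M by (simp add: simple_graph_def)
    \<comment> \<open>The average degree is at most 2C.\<close>
    obtain v where v: "v \<in> V" "vdegree (V, M) v \<le> 2 * C"
    proof (rule ccontr)
      assume "\<not> thesis"
      with that have "\<And>v. v \<in> V \<Longrightarrow> 2 * C + 1 \<le> vdegree (V, M) v" by force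
      then have "card V * (2 * C + 1) \<le> (\<Sum>v\<in>V. vdegree (V, M) v)"
        using sum_bounded_below[of V "2 * C + 1" "vdegree (V, M)"] by simp
      also have "\<dots> = 2 * card M" using sum_vdegree[OF G] by simp
      finally show False using M(2) V(2) by (simp add: algebra_simps)
    qed
    define B where "B = {x. {v, x} \<in> M}"
    have B: "card B \<le> 2 * C" using v(2) vdegree_eq_card_neighbours[OF G] by (simp add: B_def)
    have BV: "B \<subseteq> V - {v}" using M(1) by (auto simp: B_def all_pairs_def)
    define V' where "V' = V - insert v B"
    have "finite B" using BV V(1) finite_subset by blast
    then have "card (insert v B) \<le> 2 * C + 1" using B by (simp add: card_insert_if)
    then have cV': "card V \<le> card V' + 2 * C + 1"
      using diff_card_le_card_Diff[of "insert v B" V] \<open>finite B\<close> by (simp add: V'_def)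
    define M' where "M' = M \<inter> all_pairs V'"
    have "card M' \<le> card M"
      using M(1) V(1) finite_all_pairs finite_subset unfolding M'_def by (metis card_mono inf_le1)
    also have "\<dots> \<le> C * (2 * card V')"
      using M(2) cV' V(2) by (elim order_trans, intro mult_left_mono) auto
    finally have "card M' \<le> 2 * C * card V'" by (simp add: mult.assoc mult.left_commute)
    then obtain S where S: "S \<subseteq> V'" "card S = m" "all_pairs S \<inter> M' = {}"
      using N0[of V' M'] V cV' by (auto simp: V'_def M'_def)
    have "all_pairs (insert v S) \<inter> M = {}"
    proof (rule ccontr)
      assume "all_pairs (insert v S) \<inter> M \<noteq> {}"
      then obtain e where "e \<in> M" "e \<in> all_pairs (insert v S)" by blast
      then obtain x y where xy: "{x, y} \<in> M" "x \<noteq> y" "x \<in> insert v S" "y \<in> insert v S"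
        unfolding all_pairs_iff by metis
      have nB: "s \<notin> B" if "s \<in> S" for s using S(1) that by (auto simp: V'_def)
      from xy consider "x = v" "y \<in> S" | "y = v" "x \<in> S" | "x \<in> S" "y \<in> S" by auto
      then show False
      proof cases
        case 1
        then show False using xy(1) nB by (simp add: B_def)
      next
        case 2
        then have "{v, x} \<in> M" using xy(1) by (simp add: insert_commute)
        then show False using 2 nB by (simp add: B_def)
      next
        case 3
        then have "{x, y} \<in> all_pairs S" using xy by simp
        then have "{x, y} \<in> M'" using xy S(1) all_pairs_mono unfolding M'_def by blast
        then show False using S(3) \<open>{x, y} \<in> all_pairs S\<close> by blast
      qed
    qed
    moreover have "v \<notin> S" "finite S" "insert v S \<subseteq> V"
      using S(1) V(1) v(1) finite_subset[of S V] by (auto simp: V'_def)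
    ultimately show "\<exists>S\<subseteq>V. card S = Suc m \<and> all_pairs S \<inter> M = {}"
      using S(2) by (intro exI[of _ "insert v S"]) auto
  qed
qed

lemma card_edges_le_extremal_number:
  fixes G :: "nat graph"
  assumes "simple_graph G" "\<forall>F\<in>\<F>. \<not> contains_copy G F"
  shows "ereal (real (card (edges G))) \<le> extremal_number (card (verts G)) \<F>"
  unfolding extremal_number_def by (rule SUP_upper) (use assms in simp)

text \<open>Every injection into a clique is an embedding, whatever the edges of
  \<open>F\<close>.\<close>

lemma contains_copy_of_clique:
  assumes "simple_graph F" "finite S" "card (verts F) \<le> card S"
    "S \<subseteq> verts G" "all_pairs S \<subseteq> edges G"
  shows "contains_copy G F"
proof -
  obtain \<phi> where \<phi>: "inj_on \<phi> (verts F)" "\<phi> ` verts F \<subseteq> S"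
    using card_le_inj[of "verts F" S] assms by (auto simp: simple_graph_def)
  have "\<phi> ` e \<in> all_pairs S" if e: "e \<in> edges F" for e
  proof -
    obtain x y where "x \<in> verts F" "y \<in> verts F" "x \<noteq> y" "e = {x, y}"
      using simple_graph_edgeE[OF assms(1) e] by metis
    then show ?thesis using \<phi> by (auto simp: inj_on_def image_subset_iff)
  qed
  then show ?thesis unfolding contains_copy_def embedding_def
    using \<phi> assms by (intro exI[of _ \<phi>]) auto
qed

lemma simple_graph_delete_verts: "simple_graph H \<Longrightarrow> simple_graph (delete_verts H S)"
  unfolding simple_graph_def delete_verts_def all_pairs_def by auto

text \<open>A single member F of the family gives the bound. If at most 3N edges are missing from a
  large N-vertex graph, the graph of missing edges has an independent set of the order of F; this is
  a clique of the given graph and contains F. So a graph avoiding F misses at least 3N + 1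
  edges.\<close>

lemma ex_threshold:
  assumes H: "simple_graph H" "edges H \<noteq> {}"
  shows "\<exists>n\<ge>1. \<forall>N\<in>{n - 1, n}. extremal_number N (edge_deletion_family H)
                          \<le> ereal (real (N choose 2) - 2 * real N - 2)"
proof -
  obtain e where e: "e \<in> edges H" using H by auto
  obtain x y where xy: "{x, y} \<in> edges H" using simple_graph_edgeE[OF H(1) e] e by metis
  define F where "F = delete_verts H {x, y}"
  have F: "F \<in> edge_deletion_family H" "simple_graph F"
    using xy H(1) by (auto simp: F_def edge_deletion_family_def simple_graph_delete_verts)
  obtain N0 where N0: "\<And>(V :: nat set) M. finite V \<Longrightarrow> N0 \<le> card V \<Longrightarrow> M \<subseteq> all_pairs V \<Longrightarrow>
      card M \<le> 3 * card V \<Longrightarrow> \<exists>S\<subseteq>V. card S = card (verts F) \<and> all_pairs S \<inter> M = {}"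
    using sparse_graph_independent_set[of 3 "card (verts F)"] by metis
  \<comment> \<open>The summand 1 ensures N \<ge> 1, and then 3N + 1 \<ge> 2N + 2.\<close>
  have "extremal_number N (edge_deletion_family H) \<le> ereal (real (N choose 2) - 2 * real N - 2)"
    if N: "N0 + 1 \<le> N" for N
    unfolding extremal_number_def
  proof (rule SUP_least, clarify)
    fix V E assume G: "simple_graph (V :: nat set, E)" and cN: "N = card (verts (V, E))"
      and nc: "\<forall>F\<in>edge_deletion_family H. \<not> contains_copy (V, E) F"
    have V: "finite V" "E \<subseteq> all_pairs V" using G by (auto simp: simple_graph_def)
    have "\<not> card (all_pairs V - E) \<le> 3 * card V"
    proof
      assume "card (all_pairs V - E) \<le> 3 * card V"
      then obtain S where S: "S \<subseteq> V" "card S = card (verts F)" "all_pairs S \<inter> (all_pairs V - E) = {}"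
        using N0[of V "all_pairs V - E"] V N cN by auto
      then have "contains_copy (V, E) F"
        using all_pairs_mono[OF S(1)] finite_subset[OF S(1) V(1)]
        by (intro contains_copy_of_clique[OF F(2), of S]) auto
      then show False using nc F(1) by auto
    qed
    then have "card E + 3 * N + 1 \<le> N choose 2"
      using V cN card_all_pairs[OF V(1)] finite_all_pairs[OF V(1)]
        card_Diff_subset[of E "all_pairs V"] card_mono[of "all_pairs V" E] finite_subset[of E "all_pairs V"]
      by auto
    then have "real (card E) + 3 * real N + 1 \<le> real (N choose 2)"
      by (simp flip: of_nat_mult of_nat_add add: of_nat_le_iff)
    then show "ereal (real (card (edges (V, E)))) \<le>
        ereal (real (card (verts (V, E)) choose 2) - 2 * real (card (verts (V, E))) - 2)"
      using N cN by simp
  qed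
  then have "extremal_number N (edge_deletion_family H) \<le> ereal (real (N choose 2) - 2 * real N - 2)"
    if "N \<in> {N0 + 2 - 1, N0 + 2}" for N
  proof -
    have "N0 + 1 \<le> N" using that by auto
    then show ?thesis by fact
  qed
  \<comment> \<open>With \<open>N0 + 2\<close> both n - 1 and n are at least
    \<open>N0 + 1\<close>.\<close>
  then show ?thesis by (intro exI[of _ "N0 + 2"] conjI ballI) auto
qed

lemma extremal_number_threshold:
  assumes "simple_graph H" "edges H \<noteq> {}"
  shows "N \<in> {threshold H - 1, threshold H} \<Longrightarrow>
      extremal_number N (edge_deletion_family H) \<le> ereal (real (N choose 2) - 2 * real N - 2)"
    and "threshold H \<ge> 1"
  using LeastI_ex[OF ex_threshold[OF assms]] unfolding threshold_def by blast+

text \<open>Here the condition on n - 1 in \<open>threshold\<close> is used. If H had at least f + 2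
  vertices, every H - {x, y} would have at least f, so the complete graph on f - 1 vertices would
  avoid the family, although it has more edges than the extremal bound allows.\<close>

lemma card_verts_le_threshold:
  assumes H: "simple_graph H" "edges H \<noteq> {}"
  shows "card (verts H) \<le> threshold H + 1"
proof (rule ccontr)
  assume c: "\<not> ?thesis"
  define N where "N = threshold H - 1"
  define G where "G = ({..<N}, all_pairs {..<N})"
  have G: "simple_graph G" "card (verts G) = N" "card (edges G) = N choose 2"
    by (auto simp: G_def simple_graph_def card_all_pairs)
  have "\<forall>F\<in>edge_deletion_family H. \<not> contains_copy G F"
  proof (intro ballI notI)
    fix F assume "F \<in> edge_deletion_family H" "contains_copy G F"
    then obtain x y \<phi> where xy: "{x, y} \<in> edges H" "F = delete_verts H {x, y}"
      and \<phi>: "inj_on \<phi> (verts F)" "\<phi> ` verts F \<subseteq> verts G"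
      unfolding edge_deletion_family_def contains_copy_def embedding_def by auto
    have "card (verts F) \<le> N"
      using card_inj_on_le[OF \<phi>] G(2) by (simp add: G_def)
    then show False
      using c card_delete_two[OF H(1) xy(1)] extremal_number_threshold(2)[OF H]
      unfolding xy(2) N_def by linarith
  qed
  then have "ereal (real (N choose 2)) \<le> ereal (real (N choose 2) - 2 * real N - 2)"
    using card_edges_le_extremal_number[OF G(1)] extremal_number_threshold(1)[OF H, of N] G
    by (metis N_def insertI1 order_trans)
  then show False by simp
qed

section \<open>Rainbow copies through a new edge\<close>

text \<open>The colour of the new edge \<open>{v, u}\<close> is repeated on at most one old edge; that edge has an
  endpoint \<open>z\<close> in the clique other than \<open>u\<close>, and the copy is chosen to avoid \<open>z\<close>.\<close>

lemma rainbow_copy_attach: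
  fixes H :: "'a graph" and G :: "'b graph"
  assumes H: "simple_graph H" "w \<in> verts H" "vdegree H w = d" "d \<ge> 1"
    and K: "finite K" "card (verts H) \<le> card K" "K \<subseteq> verts G" "all_pairs K \<subseteq> E"
    and D: "D \<subseteq> K" "d \<le> 1 \<or> d \<le> card D" "\<And>p. p \<in> D \<Longrightarrow> {v, p} \<in> E"
    and uv: "u \<in> K" "u \<notin> D" "v \<in> verts G" "v \<notin> K" "{v, u} \<notin> E"
    and E: "E \<subseteq> all_pairs (verts G)" "E \<subseteq> edges G" "{v, u} \<in> edges G" "inj_on c E"
  shows "rainbow_copy_through H G c {v, u}"
proof -
  have finH: "finite (verts H)" using H by (simp add: simple_graph_def)
  define B where "B = {x. {w, x} \<in> edges H}"
  have cB: "card B = d" using vdegree_eq_card_neighbours[OF H(1)] H(3) by (simp add: B_def)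
  have BH: "B \<subseteq> verts H - {w}" using H(1) by (auto simp: B_def simple_graph_def all_pairs_def)
  have finB: "finite B" using BH finH finite_subset by blast
  have card2: "2 \<le> card (verts H)"
  proof -
    have "card (insert w B) \<le> card (verts H)" using BH H(2) finH by (intro card_mono) auto
    then show ?thesis using cB H(4) finB BH by (auto simp: card_insert_if split: if_splits)
  qed
  obtain z where z: "z \<in> K" "z \<noteq> u"
    and zE: "\<And>e. e \<in> E \<Longrightarrow> e \<subseteq> insert v K \<Longrightarrow> c e = c {v, u} \<Longrightarrow> z \<in> e"
  proof (cases "\<exists>e\<in>E. e \<subseteq> insert v K \<and> c e = c {v, u}")
    case True
    then obtain e where e: "e \<in> E" "e \<subseteq> insert v K" "c e = c {v, u}" by auto
    then obtain x y where "e = {x, y}" "x \<noteq> y" using E(1) by (metis all_pairs_iff subsetD)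
    moreover have "e \<noteq> {v, u}" using e uv by auto
    ultimately obtain z where "z \<in> e" "z \<in> K" "z \<noteq> u" using e(2) by (auto simp: insert_commute)
    moreover have "e' = e" if "e' \<in> E" "c e' = c {v, u}" for e'
      using inj_onD[OF E(4), of e' e] e that by simp
    ultimately show thesis using that by blast
  next
    case False
    have "K \<noteq> {u}" using card2 K(2) by auto
    then obtain z where "z \<in> K" "z \<noteq> u" using uv by auto
    then show thesis using False that by blast
  qed
  have finD: "finite D" using D K finite_subset by blast
  \<comment> \<open>The vertex \<open>u\<close> will serve as one of the d neighbours of
    \<open>w\<close>, so d - 1 vertices of \<open>D\<close> suffice for the others, even after
    discarding \<open>z\<close>.\<close>
  then have "d - 1 \<le> card (D - {z})" using D(2) by (auto simp: card_Diff_singleton_if)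
  then obtain D' where D': "D' \<subseteq> D - {z}" "card D' = d - 1" by (meson obtain_subset_with_card_n)
  have finD': "finite D'" using D' finD finite_subset by blast
  have "card (insert u D') = d" using D' uv finD' H(4) by (auto simp: card_insert_if)
  then obtain h where h: "bij_betw h B (insert u D')"
    using finite_same_card_bij[OF finB, of "insert u D'"] finD' cB by auto
  \<comment> \<open>Removing \<open>w\<close> from \<open>H\<close> pays for removing
    \<open>z\<close> from \<open>K\<close>.\<close>
  have "\<exists>g. inj_on g (verts H - {w}) \<and> g ` (verts H - {w}) \<subseteq> K - {z} \<and> (\<forall>a\<in>B. g a = h a)"
  proof (rule ex_inj_extension)
    show "card (verts H - {w}) \<le> card (K - {z})" using K H(2) z finH by simp
    show "inj_on h B" using h by (simp add: bij_betw_def)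
    show "h ` B \<subseteq> K - {z}" using h D' D(1) uv z by (auto simp: bij_betw_def)
  qed (use finH K BH in auto)
  then obtain g where g: "inj_on g (verts H - {w})" "g ` (verts H - {w}) \<subseteq> K - {z}"
    "\<And>a. a \<in> B \<Longrightarrow> g a = h a" by auto
  define \<phi> where "\<phi> = g(w := v)"
  \<comment> \<open>The copy will use only \<open>{v, u}\<close> and these old edges. All of them
    avoid \<open>z\<close>, so none has the colour of \<open>{v, u}\<close>.\<close>
  define E0 where "E0 = {e \<in> E. e \<subseteq> insert v K - {z}}"
  have im: "\<phi> ` e \<in> insert {v, u} E0" if e: "e \<in> edges H" for e
  proof -
    obtain x y where xy: "x \<in> verts H" "y \<in> verts H" "x \<noteq> y" "e = {x, y}"
      using simple_graph_edgeE[OF H(1) e] by metis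
    show ?thesis
    proof (cases "w \<in> e")
      case True
      then obtain a where a: "e = {w, a}" "a \<noteq> w" using xy by auto
      then have "a \<in> B" using e by (simp add: B_def)
      then have "h a \<in> insert u D'" using h by (auto simp: bij_betw_def)
      moreover have "\<phi> ` e = {v, h a}" using a \<open>a \<in> B\<close> g(3) by (auto simp: \<phi>_def)
      moreover have "v \<noteq> z" using z uv by auto
      ultimately show ?thesis using D D' by (auto simp: E0_def)
    next
      case False
      then have "\<phi> ` e = {g x, g y}" using xy by (auto simp: \<phi>_def)
      moreover have "g x \<noteq> g y" "g x \<in> K - {z}" "g y \<in> K - {z}"
        using g xy False by (auto simp: inj_on_def)
      moreover from this have "{g x, g y} \<in> E" using K(4) by (auto intro!: subsetD[OF K(4)])
      ultimately show ?thesis by (auto simp: E0_def)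
    qed
  qed
  have inj: "inj_on c (insert {v, u} E0)"
    unfolding inj_on_insert
  proof
    show "inj_on c E0" using E(4) by (rule inj_on_subset) (auto simp: E0_def)
    show "c {v, u} \<notin> c ` (E0 - {{v, u}})"
    proof
      assume "c {v, u} \<in> c ` (E0 - {{v, u}})"
      then obtain e where "e \<in> E0" "c e = c {v, u}" by (metis DiffD1 imageE)
      then have "e \<in> E" "e \<subseteq> insert v K - {z}" "c e = c {v, u}" by (simp_all add: E0_def)
      then show False using zE[of e] by blast
    qed
  qed
  have "embedding \<phi> H G"
    unfolding embedding_def
  proof (intro conjI)
    have *: "v \<notin> g ` (verts H - {w})" using g uv by auto
    have "inj_on \<phi> (verts H - {w})" using g(1) by (simp add: \<phi>_def inj_on_def)
    moreover have "\<phi> w \<notin> \<phi> ` (verts H - {w})" using * by (auto simp: \<phi>_def)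
    ultimately have "inj_on \<phi> (insert w (verts H - {w}))" unfolding inj_on_insert by auto
    then show "inj_on \<phi> (verts H)" unfolding insert_Diff[OF H(2)] .
    show "\<phi> ` verts H \<subseteq> verts G" using g(2) K(3) uv by (auto simp: \<phi>_def)
    show "(`) \<phi> ` edges H \<subseteq> edges G"
    proof (rule image_subsetI)
      fix e assume "e \<in> edges H"
      from im[OF this] show "\<phi> ` e \<in> edges G" using E(2,3) by (auto simp: E0_def)
    qed
  qed
  moreover have "{v, u} \<in> (`) \<phi> ` edges H"
  proof -
    have "u \<in> h ` B" using h by (simp add: bij_betw_def)
    then obtain a where a: "a \<in> B" "h a = u" by auto
    then have "\<phi> ` {w, a} = {v, u}" using g BH by (auto simp: \<phi>_def)
    then show ?thesis using imageI[of "{w, a}" "edges H" "(`) \<phi>"] a by (simp add: B_def)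
  qed
  moreover have "inj_on c ((`) \<phi> ` edges H)" using inj by (rule inj_on_subset) (rule image_subsetI, rule im)
  ultimately show ?thesis unfolding rainbow_copy_through_def by blast
qed

text \<open>The \<open>2 f(H) + 1\<close> edges meeting \<open>{v, v'}\<close> exclude at most that many edges inside \<open>W\<close>, which
  leaves more than the extremal number.\<close>

lemma rainbow_copy_join:
  fixes H :: "'a graph" and G :: "nat graph"
  assumes H: "simple_graph H" "edges H \<noteq> {}"
    and W: "finite W" "card W = threshold H" "W \<subseteq> verts G"
      "all_pairs W \<subseteq> edges G" "inj_on c (all_pairs W)"
    and v: "v \<in> verts G" "v' \<in> verts G" "v \<noteq> v'" "v \<notin> W" "v' \<notin> W"
    and A: "A = insert {v, v'} ((\<lambda>x. {v, x}) ` W \<union> (\<lambda>x. {v', x}) ` W)" "A \<subseteq> edges G" "inj_on c A"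
  shows "rainbow_copy_through H G c {v, v'}"
proof -
  let ?f = "threshold H"
  define R where "R = {e \<in> all_pairs W. c e \<notin> c ` A}"
  have finA: "finite A" using A W by simp
  have "card A \<le> 2 * ?f + 1"
  proof -
    have "card ((\<lambda>x. {v, x}) ` W) \<le> ?f" "card ((\<lambda>x. {v', x}) ` W) \<le> ?f"
      using W card_image_le by metis+
    then have "card ((\<lambda>x. {v, x}) ` W \<union> (\<lambda>x. {v', x}) ` W) \<le> 2 * ?f"
      using card_Un_le[of "(\<lambda>x. {v, x}) ` W" "(\<lambda>x. {v', x}) ` W"] by linarith
    then show ?thesis using W A by (simp add: card_insert_if)
  qed
  \<comment> \<open>Colours are distinct inside \<open>W\<close>, so each colour on \<open>A\<close>
    excludes at most one edge there.\<close>
  moreover have "card (all_pairs W - R) \<le> card (c ` A)"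
    by (rule card_inj_on_le[of c]) (use W(5) finA in \<open>auto simp: R_def inj_on_def\<close>)
  moreover have "card (c ` A) \<le> card A" using finA by (rule card_image_le)
  moreover have "card (all_pairs W) \<le> card R + card (all_pairs W - R)"
    using card_Un_le[of R "all_pairs W - R"] by (simp add: R_def Un_absorb1)
  ultimately have "?f choose 2 \<le> card R + (2 * ?f + 1)"
    using card_all_pairs[OF W(1)] unfolding W(2) by linarith
  then have "real (?f choose 2) \<le> real (card R) + (2 * real ?f + 1)"
    by (metis (mono_tags, opaque_lifting) of_nat_1 of_nat_add of_nat_le_iff of_nat_mult of_nat_numeral)
  \<comment> \<open>The bound defining \<open>threshold\<close> subtracts 2f + 2, one more than the
    number of edges lost; hence the strict inequality.\<close>
  then have big: "ereal (real (?f choose 2) - 2 * real ?f - 2) < ereal (real (card R))"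
    by simp
  have "simple_graph (W, R)" using W by (auto simp: simple_graph_def R_def)
  then have "\<exists>F\<in>edge_deletion_family H. contains_copy (W, R) F"
    using card_edges_le_extremal_number[of "(W, R)" "edge_deletion_family H"] big
      extremal_number_threshold(1)[OF H, of ?f] W(2)
    by (metis fst_conv insertI1 insertI2 not_less order_trans snd_conv)
  then obtain x y \<psi> where xy: "{x, y} \<in> edges H"
    and "embedding \<psi> (delete_verts H {x, y}) (W, R)"
    unfolding edge_deletion_family_def contains_copy_def by auto
  then have \<psi>: "inj_on \<psi> (verts H - {x, y})" "\<psi> ` (verts H - {x, y}) \<subseteq> W"
    "\<And>e. e \<in> edges H \<Longrightarrow> e \<inter> {x, y} = {} \<Longrightarrow> \<psi> ` e \<in> R"
    unfolding embedding_def delete_verts_def by auto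
  have xyV: "x \<in> verts H" "y \<in> verts H" "x \<noteq> y"
    using H(1) xy by (auto simp: simple_graph_def all_pairs_def)
  define \<phi> where "\<phi> = \<psi>(x := v, y := v')"
  have \<phi>W: "\<phi> a \<in> W" if "a \<in> verts H" "a \<noteq> x" "a \<noteq> y" for a
    using that \<psi>(2) by (auto simp: \<phi>_def)
  have \<phi>x: "\<phi> x = v" "\<phi> y = v'" using xyV by (auto simp: \<phi>_def)
  have im: "\<phi> ` e \<in> R \<union> A" if e: "e \<in> edges H" for e
  proof (cases "e \<inter> {x, y} = {}")
    case True
    then have "\<phi> ` e = \<psi> ` e" by (auto simp: \<phi>_def)
    then show ?thesis using \<psi>(3)[OF e True] by auto
  next
    case False
    obtain a b where ab: "a \<in> verts H" "b \<in> verts H" "a \<noteq> b" "e = {a, b}"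
      using simple_graph_edgeE[OF H(1) e] by metis
    with False consider "e = {x, y}" | t where "t \<in> verts H" "t \<noteq> x" "t \<noteq> y" "e = {x, t} \<or> e = {y, t}"
      by (auto simp: insert_commute)
    then show ?thesis
    proof cases
      case 1
      then show ?thesis using \<phi>x A by simp
    next
      case 2
      then show ?thesis using \<phi>W[OF 2(1-3)] \<phi>x A by auto
    qed
  qed
  \<comment> \<open>By definition \<open>R\<close> shares no colour with \<open>A\<close>, so it
    suffices that each of the two is rainbow.\<close>
  have "inj_on c (R \<union> A)"
    unfolding inj_on_Un
  proof (intro conjI)
    show "inj_on c R" using W(5) by (rule inj_on_subset) (auto simp: R_def)
    show "c ` (R - A) \<inter> c ` (A - R) = {}" by (auto simp: R_def)
  qed (fact A(3))
  then have "inj_on c ((`) \<phi> ` edges H)" by (rule inj_on_subset) (rule image_subsetI, rule im)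
  moreover have "embedding \<phi> H G"
    unfolding embedding_def
  proof (intro conjI)
    show "inj_on \<phi> (verts H)"
    proof -
      let ?U = "verts H - {x, y}"
      have U: "insert x (insert y ?U) = verts H" using xyV by auto
      have "inj_on \<phi> ?U \<longleftrightarrow> inj_on \<psi> ?U" by (rule inj_on_cong) (auto simp: \<phi>_def)
      with \<psi>(1) have "inj_on \<phi> ?U" by simp
      moreover have *: "\<phi> ` ?U \<subseteq> W" using \<phi>W by blast
      then have "\<phi> y \<notin> \<phi> ` ?U" using \<phi>x v(5) by auto
      moreover have "\<phi> x \<notin> \<phi> ` insert y ?U" using * \<phi>x v(3,4) by auto
      ultimately have "inj_on \<phi> (insert x (insert y ?U))" unfolding inj_on_insert by auto
      then show ?thesis unfolding U .
    qed
    show "\<phi> ` verts H \<subseteq> verts G" using \<phi>W \<phi>x v W(3) by blast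
    show "(`) \<phi> ` edges H \<subseteq> edges G" using im A(2) W(4) by (auto simp: R_def)
  qed
  moreover have "{v, v'} \<in> (`) \<phi> ` edges H"
    using imageI[OF xy, of "(`) \<phi>"] \<phi>x by simp
  ultimately show ?thesis unfolding rainbow_copy_through_def by blast
qed

section \<open>The saturated graph\<close>

lemma extend_coloring_nth:
  assumes "distinct es" "length cs = length es" "i < length es"
  shows "extend_coloring c es cs (es ! i) = cs ! i"
proof -
  have "map_of (zip es cs) (es ! i) = Some (cs ! i)"
    using assms by (simp add: map_of_zip_nth)
  then show ?thesis by (simp add: extend_coloring_def)
qed

lemma extend_coloring_notin:
  assumes "length cs = length es" "e \<notin> set es"
  shows "extend_coloring c es cs e = c e"
proof -
  have "map_of (zip es cs) e = None" using assms by (simp add: map_of_zip_is_None)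
  then show ?thesis by (simp add: extend_coloring_def)
qed

lemma inj_on_extend_coloring_new:
  assumes "distinct es" "length cs = length es" "distinct cs"
  shows "inj_on (extend_coloring c es cs) (set es)"
  using assms by (auto simp: inj_on_def in_set_conv_nth extend_coloring_nth nth_eq_iff_index_eq)

text \<open>Outside \<open>K\<close> the vertices are pairwise non-adjacent. The choice
  \<open>D = {}\<close> leaves them isolated, as is wanted for d = 1.\<close>

definition attached_clique :: "nat \<Rightarrow> nat set \<Rightarrow> nat set \<Rightarrow> nat graph" where
  "attached_clique n K D =
     ({..<n}, all_pairs K \<union> (\<lambda>(v, p). {v, p}) ` (({..<n} - K) \<times> D))"

lemma simple_attached_clique:
  assumes "K \<subseteq> {..<n}" "D \<subseteq> K"
  shows "simple_graph (attached_clique n K D)"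
proof -
  have "p < n" if "p \<in> D" for p using that assms by auto
  then show ?thesis using assms all_pairs_mono[OF assms(1)]
    unfolding simple_graph_def attached_clique_def by auto
qed

lemma card_edges_attached_clique:
  assumes "K \<subseteq> {..<n}" "D \<subseteq> K"
  shows "card (edges (attached_clique n K D)) = (card K choose 2) + (n - card K) * card D"
proof -
  have fin: "finite K" using assms(1) by (rule finite_subset) simp
  have finD: "finite D" using assms(2) fin by (rule finite_subset)
  let ?P = "(\<lambda>(v, p). {v, p}) ` (({..<n} - K) \<times> D)"
  \<comment> \<open>The two ends of an attaching edge are told apart by membership in
    \<open>K\<close>.\<close>
  have "inj_on (\<lambda>(v, p). {v, p}) (({..<n} - K) \<times> D)"
  proof (rule inj_onI, clarify)
    fix v p v' p' assume "v \<notin> K" "v' \<notin> K" "p \<in> D" "p' \<in> D" and eq: "{v, p} = {v', p'}"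
    then have "v \<noteq> p'" "v' \<noteq> p" using assms(2) by auto
    then show "v = v' \<and> p = p'" using eq by (metis doubleton_eq_iff)
  qed
  then have "card ?P = (n - card K) * card D"
    using assms fin finD by (simp add: card_image card_cartesian_product card_Diff_subset)
  moreover have "all_pairs K \<inter> ?P = {}" by (auto simp: all_pairs_def)
  ultimately show ?thesis
    using fin finD unfolding attached_clique_def snd_conv
    by (subst card_Un_disjoint) (auto simp: card_all_pairs finite_all_pairs)
qed

text \<open>The ordering lists the non-edges meeting \<open>K\<close> first (\<open>la\<close>),
  handled by \<open>rainbow_copy_attach\<close>, and those outside \<open>K\<close> last
  (\<open>lb\<close>), handled by \<open>rainbow_copy_join\<close>. The graph itself gets an
  injective colouring.\<close>

lemma saturated_attached_clique:
  fixes H :: "'a graph"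
  assumes H: "simple_graph H" "w \<in> verts H" "vdegree H w = d" "d \<ge> 1"
    and K: "K \<subseteq> {..<n}" "card (verts H) \<le> card K"
    and D: "D \<subseteq> K" "d \<le> 1 \<or> d \<le> card D" "card D + threshold H \<le> card K"
  shows "\<exists>c. weakly_rainbow_saturated H (attached_clique n K D) c"
proof -
  define G where "G = attached_clique n K D"
  have G: "simple_graph G" "verts G = {..<n}"
    using simple_attached_clique[OF K(1) D(1)] by (auto simp: G_def attached_clique_def)
  have KG: "all_pairs K \<subseteq> edges G" by (auto simp: G_def attached_clique_def)
  have DG: "{v, p} \<in> edges G" if "v < n" "v \<notin> K" "p \<in> D" for v p
    using that by (auto simp: G_def attached_clique_def)
  have "finite K" using K(1) by (rule finite_subset) simp
  moreover have "finite D" using D(1) \<open>finite K\<close> by (rule finite_subset)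
  ultimately have finK: "finite K" "finite D" by simp_all
  have eH: "edges H \<noteq> {}" using H(3,4) by (auto simp: vdegree_def)
  obtain c :: "nat set \<Rightarrow> nat" where c: "inj_on c (edges G)"
    using finite_imp_inj_to_nat_seg[OF simple_graph_finite_edges[OF G(1)]] by blast
  have "threshold H \<le> card (K - D)" using D(1,3) finK by (simp add: card_Diff_subset)
  \<comment> \<open>Outside vertices are not joined to \<open>K - D\<close> in \<open>G\<close>, so
    all their edges to \<open>W\<close> will be new and carry distinct colours.\<close>
  then obtain W where W: "W \<subseteq> K - D" "card W = threshold H" by (meson obtain_subset_with_card_n)
  have finW: "finite W" using W finK finite_subset by blast
  have finN: "finite (non_edges G)" by (simp add: non_edges_def finite_all_pairs G)
  obtain la where la: "set la = {e \<in> non_edges G. e \<inter> K \<noteq> {}}" "distinct la"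
    using finite_distinct_list[of "{e \<in> non_edges G. e \<inter> K \<noteq> {}}"] finN by auto
  obtain lb where lb: "set lb = {e \<in> non_edges G. e \<inter> K = {}}" "distinct lb"
    using finite_distinct_list[of "{e \<in> non_edges G. e \<inter> K = {}}"] finN by auto
  define es where "es = la @ lb"
  have es: "distinct es" "set es = non_edges G" using la lb by (auto simp: es_def)
  have "rainbow_copy_through H (add_edges G (take (Suc i) es))
          (extend_coloring c (take (Suc i) es) (take (Suc i) cs)) (es ! i)"
    if cs: "length cs = length es" "distinct cs" and i: "i < length es" for cs i
  proof -
    define fs where "fs = take (Suc i) es"
    define c' where "c' = extend_coloring c fs (take (Suc i) cs)"
    define G' where "G' = add_edges G fs"
    have G': "verts G' = {..<n}" "edges G' = edges G \<union> set fs"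
      by (auto simp: G'_def add_edges_def G)
    have fs: "set fs \<subseteq> non_edges G" "distinct fs" "length (take (Suc i) cs) = length fs"
      using es set_take_subset[of "Suc i" es] cs by (simp_all add: fs_def)
    have ei_fs: "es ! i \<in> set fs" using i by (simp add: fs_def take_Suc_conv_app_nth)
    \<comment> \<open>Old and new edges are each rainbow on their own; an old and a new edge may
      still share a colour.\<close>
    have c'_new: "inj_on c' (set fs)"
      unfolding c'_def by (rule inj_on_extend_coloring_new[OF fs(2,3)]) (use cs in simp)
    have "c' e = c e" if "e \<in> edges G" for e
    proof -
      have "e \<notin> set fs" using fs(1) that by (auto simp: non_edges_def)
      then show ?thesis unfolding c'_def by (rule extend_coloring_notin[OF fs(3)])
    qed
    then have c'_old: "inj_on c' (edges G)" using c by (simp cong: inj_on_cong)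
    have ei: "es ! i \<in> non_edges G" using fs(1) ei_fs by blast
    have EG: "edges G \<subseteq> all_pairs (verts G')" using G G'(1) by (simp add: simple_graph_def)
    have "rainbow_copy_through H G' c' (es ! i)"
    proof (cases "es ! i \<inter> K = {}")
      case False
      from ei obtain x y where xy: "x < n" "y < n" "x \<noteq> y" "es ! i = {x, y}"
        by (auto simp: non_edges_def all_pairs_iff G)
      have "\<not> (x \<in> K \<and> y \<in> K)" using subsetD[OF KG, of "{x, y}"] xy ei by (auto simp: non_edges_def)
      moreover have "x \<in> K \<or> y \<in> K" using False xy(4) by auto
      moreover have "es ! i = {y, x}" using xy(4) by (simp add: insert_commute)
      ultimately obtain u v where uv: "u \<in> K" "v \<notin> K" "v < n" "es ! i = {v, u}"
        using xy by metis
      have "rainbow_copy_through H G' c' {v, u}"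
      proof (rule rainbow_copy_attach[OF H finK(1) K(2) _ KG D(1,2) _ uv(1)])
        show "u \<notin> D" using DG[OF uv(3,2)] ei uv(4) by (auto simp: non_edges_def)
        show "{v, u} \<notin> edges G" using ei uv(4) by (auto simp: non_edges_def)
        show "{v, u} \<in> edges G'" using ei_fs uv(4) G' by auto
      qed (use uv DG G' K EG c'_old in auto)
      then show ?thesis using uv by simp
    next
      case True
      from ei obtain v v' where v: "v < n" "v' < n" "v \<noteq> v'" "es ! i = {v, v'}"
        by (auto simp: non_edges_def all_pairs_iff G)
      then have vK: "v \<notin> K" "v' \<notin> K" using True by auto
      \<comment> \<open>An edge outside \<open>K\<close> comes after all of \<open>la\<close>, so
        every outside vertex is already joined to all of \<open>W\<close>.\<close>
      have "i \<ge> length la"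
      proof (rule ccontr)
        assume "\<not> ?thesis"
        then have "es ! i \<in> set la" by (simp add: es_def nth_append)
        then show False using la True by auto
      qed
      then have la_fs: "set la \<subseteq> set fs" by (auto simp: fs_def es_def)
      have new: "{t, x} \<in> set fs" if "t < n" "t \<notin> K" "x \<in> W" for t x
      proof -
        have x: "x \<in> K" "x \<notin> D" using that W by auto
        then have "{t, x} \<notin> edges G"
          using that D(1) by (auto simp: G_def attached_clique_def doubleton_eq_iff)
        moreover have "{t, x} \<in> all_pairs (verts G)"
          using that x K(1) by (auto simp: G)
        ultimately show ?thesis using la la_fs x by (auto simp: non_edges_def)
      qed
      have WK: "all_pairs W \<subseteq> all_pairs K" using W by (intro all_pairs_mono) auto
      define A where "A = insert {v, v'} ((\<lambda>x. {v, x}) ` W \<union> (\<lambda>x. {v', x}) ` W)"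
      have A: "A \<subseteq> set fs" using new v vK ei_fs by (auto simp: A_def)
      have "rainbow_copy_through H G' c' {v, v'}"
      proof (rule rainbow_copy_join[OF H(1) eH finW W(2) _ _ _ _ _ v(3) _ _ A_def])
        show "inj_on c' (all_pairs W)" using c'_old WK KG by (meson inj_on_subset order_trans)
        show "inj_on c' A" using c'_new A by (rule inj_on_subset)
        show "all_pairs W \<subseteq> edges G'" using WK KG G'(2) by auto
        show "A \<subseteq> edges G'" using A G'(2) by auto
        show "W \<subseteq> verts G'" "v \<notin> W" "v' \<notin> W" using W(1) K(1) vK G'(1) by auto
      qed (use v G'(1) in auto)
      then show ?thesis using v by simp
    qed
    then show ?thesis by (simp add: G'_def c'_def fs_def)
  qed
  then show ?thesis unfolding weakly_rainbow_saturated_def G_def[symmetric] using es by blast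
qed

section \<open>Passing from saturated graphs to \<open>rwsat\<close>\<close>

lemma rwsat_le:
  fixes G :: "nat graph"
  assumes "simple_graph G" "card (verts G) = n" "weakly_rainbow_saturated H G c"
  shows "rwsat n H \<le> card (edges G)"
proof -
  let ?S = "{card (edges G) | (G :: nat graph) c.
                 simple_graph G \<and> card (verts G) = n \<and> weakly_rainbow_saturated H G c}"
  have "card (edges G) \<in> ?S" using assms by blast
  then show ?thesis unfolding rwsat_def Let_def by (auto intro: Least_le)
qed

lemma rwsat_witness:
  fixes H :: "'a graph"
  obtains "rwsat n H = n choose 2"
  | G :: "nat graph" and c where "rwsat n H = card (edges G)" "simple_graph G" "card (verts G) = n"
      "weakly_rainbow_saturated H G c"
proof -
  define S where "S = {card (edges G) | (G :: nat graph) c.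
                 simple_graph G \<and> card (verts G) = n \<and> weakly_rainbow_saturated H G c}"
  have eq: "rwsat n H = (if S = {} then n choose 2 else (LEAST k. k \<in> S))"
    unfolding rwsat_def S_def Let_def ..
  show thesis
  proof (cases "S = {}")
    case True
    then show thesis using that(1) eq by simp
  next
    case False
    then obtain k where "k \<in> S" by auto
    then have "(LEAST k. k \<in> S) \<in> S" by (rule LeastI)
    then have "rwsat n H \<in> S" using eq False by simp
    then show thesis using that(2) unfolding S_def by blast
  qed
qed

text \<open>Here s is the size of \<open>D\<close>: s = 0 is allowed for d = 1, and otherwise s = d.
  The clique has f + d vertices, which leaves f of them outside \<open>D\<close> and is at least the
  order of H, because that order is at most f + 1.\<close>

lemma rwsat_upper_bound:
  fixes H :: "'a graph"
  assumes H: "simple_graph H" "w \<in> verts H" "vdegree H w = d" "d \<ge> 1"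
    and s: "d \<le> 1 \<or> d \<le> s" "s \<le> d" and n: "threshold H + d < n"
  shows "rwsat n H \<le> ((threshold H + d) choose 2) + (n - (threshold H + d)) * s"
proof -
  let ?k = "threshold H + d"
  have eH: "edges H \<noteq> {}" using H(3,4) by (auto simp: vdegree_def)
  have sub: "{..<?k} \<subseteq> {..<n}" "{..<s} \<subseteq> {..<?k}" using n s by auto
  have "\<exists>c. weakly_rainbow_saturated H (attached_clique n {..<?k} {..<s}) c"
    by (rule saturated_attached_clique[OF H sub(1) _ sub(2)])
      (use s H(4) card_verts_le_threshold[OF H(1) eH] in auto)
  then obtain c where "weakly_rainbow_saturated H (attached_clique n {..<?k} {..<s}) c" by blast
  then have "rwsat n H \<le> card (edges (attached_clique n {..<?k} {..<s}))"
    by (intro rwsat_le[OF simple_attached_clique[OF sub]]) (simp_all add: attached_clique_def)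
  then show ?thesis using card_edges_attached_clique[OF sub] by simp
qed

section \<open>The lower bound\<close>

lemma min_nonzero_degree:
  assumes H: "simple_graph H" "edges H \<noteq> {}"
  shows "\<exists>w\<in>verts H. vdegree H w = min_nonzero_degree H" "min_nonzero_degree H \<noteq> 0"
    and "\<And>v. v \<in> verts H \<Longrightarrow> vdegree H v \<noteq> 0 \<Longrightarrow> min_nonzero_degree H \<le> vdegree H v"
proof -
  let ?D = "{vdegree H v | v. v \<in> verts H \<and> vdegree H v \<noteq> 0}"
  have fin: "finite ?D" using H(1) by (simp add: simple_graph_def)
  obtain e where e: "e \<in> edges H" using H by auto
  obtain x y where "x \<in> verts H" "e = {x, y}" using simple_graph_edgeE[OF H(1) e] by metis
  then have "vdegree H x \<noteq> 0"
    using e simple_graph_finite_edges[OF H(1)] by (auto simp: vdegree_def)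
  then have "?D \<noteq> {}" using \<open>x \<in> verts H\<close> by blast
  then have "min_nonzero_degree H \<in> ?D" unfolding min_nonzero_degree_def using fin Min_in by blast
  then show "\<exists>w\<in>verts H. vdegree H w = min_nonzero_degree H" "min_nonzero_degree H \<noteq> 0" by auto
  show "min_nonzero_degree H \<le> vdegree H v" if "v \<in> verts H" "vdegree H v \<noteq> 0" for v
    unfolding min_nonzero_degree_def using fin that by (intro Min_le) auto
qed

text \<open>If \<open>v\<close> had smaller degree, the copy through the first new edge at \<open>v\<close> would use every edge
  at \<open>v\<close>, so giving the new edge the colour of an old one there destroys it.\<close>

lemma min_degree_weakly_rainbow_saturated:
  fixes H :: "'a graph" and G :: "'b graph"
  assumes H: "simple_graph H" and d: "2 \<le> d" "\<And>w. w \<in> verts H \<Longrightarrow> vdegree H w \<noteq> 0 \<Longrightarrow> d \<le> vdegree H w"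
    and G: "simple_graph G" "d < card (verts G)" "weakly_rainbow_saturated H G c" "v \<in> verts G"
  shows "d \<le> vdegree G v"
proof (rule ccontr)
  assume "\<not> ?thesis"
  then have deg: "vdegree G v < d" by simp
  have finV: "finite (verts G)" using G by (simp add: simple_graph_def)
  have finE: "finite (edges G)" using simple_graph_finite_edges[OF G(1)] .
  obtain es where es: "distinct es" "set es = non_edges G"
    and sat: "\<And>cs i. length cs = length es \<Longrightarrow> distinct cs \<Longrightarrow> i < length es \<Longrightarrow>
              rainbow_copy_through H (add_edges G (take (Suc i) es))
                (extend_coloring c (take (Suc i) es) (take (Suc i) cs)) (es ! i)"
    using G(3) unfolding weakly_rainbow_saturated_def by blast
  have "\<exists>i. i < length es \<and> v \<in> es ! i"
  proof -
    let ?B = "{x. {v, x} \<in> edges G}"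
    have B: "?B \<subseteq> verts G" "v \<notin> ?B" using G(1) by (auto simp: simple_graph_def all_pairs_def)
    then have finB: "finite ?B" using finV finite_subset by blast
    \<comment> \<open>The vertex \<open>v\<close> and its neighbours number at most d, fewer than
      all vertices, so some non-edge at \<open>v\<close> exists.\<close>
    have "card (insert v ?B) < card (verts G)"
      using deg G(2) B finB vdegree_eq_card_neighbours[OF G(1), of v] by (simp add: card_insert_if)
    then have "\<not> verts G \<subseteq> insert v ?B" using card_mono[of "insert v ?B" "verts G"] finB by auto
    then obtain x where "x \<in> verts G" "x \<noteq> v" "{v, x} \<notin> edges G" by auto
    then have "{v, x} \<in> set es" using G(4) es by (simp add: non_edges_def)
    then show ?thesis by (metis in_set_conv_nth insertI1)
  qed
  then obtain i where i: "i < length es" "v \<in> es ! i" and min: "\<And>j. j < i \<Longrightarrow> v \<notin> es ! j"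
    using exists_least_iff[of "\<lambda>i. i < length es \<and> v \<in> es ! i"] by (metis less_trans)
  define X where "X = {e \<in> edges G. v \<in> e}"
  \<comment> \<open>The colours must be fixed before a copy is available, and only the copy will
    show that \<open>X\<close> is nonempty; until then \<open>e0\<close> is an arbitrary
    choice.\<close>
  define e0 where "e0 = (SOME e. e \<in> X)"
  define k where "k = c e0"
  \<comment> \<open>The first new edge at \<open>v\<close> receives the colour \<open>k\<close> of
    \<open>e0\<close>; the other colours exceed \<open>k\<close> and are pairwise distinct.\<close>
  define cs where "cs = map (\<lambda>j. if j = i then k else k + 1 + j) [0..<length es]"
  have cs: "length cs = length es" "distinct cs"
    by (auto simp: cs_def distinct_map inj_on_def)
  define fs where "fs = take (Suc i) es"
  define c' where "c' = extend_coloring c fs (take (Suc i) cs)"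
  obtain \<phi> where \<phi>: "embedding \<phi> H (add_edges G fs)" "es ! i \<in> (`) \<phi> ` edges H"
    "inj_on c' ((`) \<phi> ` edges H)"
    using sat[OF cs i(1)] unfolding rainbow_copy_through_def fs_def c'_def by blast
  have inj: "inj_on \<phi> (verts H)" and imE: "(`) \<phi> ` edges H \<subseteq> edges G \<union> set fs"
    using \<phi>(1) by (auto simp: embedding_def add_edges_def)
  obtain e where e: "e \<in> edges H" "es ! i = \<phi> ` e" using \<phi>(2) by auto
  then obtain w where w: "w \<in> e" "\<phi> w = v" using i(2) by auto
  have HE: "e \<subseteq> verts H" if "e \<in> edges H" for e
    using H that by (auto simp: simple_graph_def all_pairs_def)
  have finH: "finite (edges H)" using simple_graph_finite_edges[OF H] .
  have "vdegree H w \<noteq> 0" using e w finH by (auto simp: vdegree_def)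
  then have dw: "d \<le> vdegree H w" using d HE e w by blast
  define Y where "Y = (`) \<phi> ` {e \<in> edges H. w \<in> e}"
  have "inj_on ((`) \<phi>) {e \<in> edges H. w \<in> e}"
    using inj HE by (intro inj_onI) (metis (no_types, lifting) inj_on_image_eq_iff mem_Collect_eq)
  then have cY: "d \<le> card Y" using dw by (simp add: Y_def card_image vdegree_def)
  have fs_v: "e = es ! i" if "e \<in> set fs" "v \<in> e" for e
    using that min i(1) by (auto simp: fs_def in_set_conv_nth less_Suc_eq)
  have YX: "Y \<subseteq> insert (es ! i) X"
    using imE fs_v w by (auto simp: Y_def X_def)
  have finX: "finite X" using finE by (simp add: X_def)
  have cX: "card (insert (es ! i) X) \<le> d"
    using deg finX by (simp add: card_insert_if X_def vdegree_def)
  \<comment> \<open>Counting is tight: the copy needs at least d edges at \<open>v\<close>, and at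
    most d are present.\<close>
  have Yeq: "Y = insert (es ! i) X"
    using card_seteq[OF _ YX] finX cX cY by simp
  \<comment> \<open>As d \<ge> 2, the copy uses an old edge at \<open>v\<close> besides the new
    one.\<close>
  have "X \<noteq> {}" using cY Yeq d(1) by auto
  then have e0: "e0 \<in> X" unfolding e0_def by (simp add: some_in_eq)
  have ne: "e \<notin> edges G" if "e \<in> set fs" for e
    using that es set_take_subset[of "Suc i" es] by (auto simp: fs_def non_edges_def)
  have ifs: "es ! i \<in> set fs" using i by (auto simp: fs_def take_Suc_conv_app_nth)
  have "c' e0 = k"
    using e0 ne cs unfolding c'_def k_def X_def by (intro extend_coloring_notin) (auto simp: fs_def)
  moreover have "c' (es ! i) = k"
    using extend_coloring_nth[of fs "take (Suc i) cs" i c] es(1) cs i(1)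
    by (simp add: c'_def fs_def cs_def)
  moreover have "e0 \<in> (`) \<phi> ` edges H"
  proof -
    have "Y \<subseteq> (`) \<phi> ` edges H" unfolding Y_def by (rule image_mono) auto
    moreover have "e0 \<in> Y" using e0 Yeq by simp
    ultimately show ?thesis ..
  qed
  moreover have "e0 \<noteq> es ! i" using e0 ne ifs by (auto simp: X_def)
  ultimately show False using inj_onD[OF \<phi>(3), of e0 "es ! i"] \<phi>(2) by simp
qed

text \<open>For a minimal saturated graph the degrees are summed. The default value n choose 2 also
  satisfies the bound, because d \<le> n - 1.\<close>

lemma rwsat_lower_bound:
  fixes H :: "'a graph"
  assumes H: "simple_graph H" and d: "2 \<le> d" "\<And>w. w \<in> verts H \<Longrightarrow> vdegree H w \<noteq> 0 \<Longrightarrow> d \<le> vdegree H w"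
    and n: "d < n"
  shows "d * n \<le> 2 * rwsat n H"
proof (cases rule: rwsat_witness[of n H])
  case 1
  have "2 * (n choose 2) = n * (n - 1)"
  proof -
    have "even (n * (n - 1))" by (cases n) auto
    then show ?thesis by (simp only: choose_two dvd_mult_div_cancel)
  qed
  moreover have "d * n \<le> n * (n - 1)" using n by simp
  ultimately show ?thesis using 1 by simp
next
  case (2 G c)
  have "card (verts G) * d \<le> (\<Sum>v\<in>verts G. vdegree G v)"
    using sum_bounded_below[of "verts G" d "vdegree G"]
      min_degree_weakly_rainbow_saturated[OF H d 2(2) _ 2(4)] 2(3) n by simp
  then show ?thesis using sum_vdegree[OF 2(2)] 2 by (simp add: mult.commute)
qed

section \<open>Graphs with and without pendant edges\<close>

theorem theorem3p1:
  fixes H :: "'a graph" and n :: nat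
  assumes "simple_graph H" and "edges H \<noteq> {}"
  shows "((\<exists>e. pendant_edge H e) \<and> n > threshold H + 1 \<longrightarrow>
            rwsat n H \<le> (threshold H + 1) choose 2) \<and>
         (\<not> (\<exists>e. pendant_edge H e) \<and> n > threshold H + min_nonzero_degree H \<longrightarrow>
            1 / 2 * real (min_nonzero_degree H) * real n \<le> real (rwsat n H) \<and>
            real (rwsat n H) \<le>
              real (min_nonzero_degree H) * (real n - real (threshold H) - real (min_nonzero_degree H))
              + real ((threshold H + min_nonzero_degree H) choose 2))"
proof (intro conjI impI; elim conjE)
  assume "\<exists>e. pendant_edge H e" and n: "threshold H + 1 < n"
  then obtain e w where "e \<in> edges H" "w \<in> e" "vdegree H w = 1" by (auto simp: pendant_edge_def)
  moreover from this have "w \<in> verts H" using assms(1) by (auto simp: simple_graph_def all_pairs_def)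
  ultimately show "rwsat n H \<le> (threshold H + 1) choose 2"
    \<comment> \<open>For d = 1 the set \<open>D\<close> is empty, so the term linear in n
      vanishes.\<close>
    using rwsat_upper_bound[OF assms(1), of w 1 0 n] n by simp
next
  let ?d = "min_nonzero_degree H"
  assume np: "\<nexists>e. pendant_edge H e" and n: "threshold H + ?d < n"
  obtain w where w: "w \<in> verts H" "vdegree H w = ?d"
    using min_nonzero_degree(1)[OF assms] by auto
  have d0: "?d \<noteq> 0" using min_nonzero_degree(2)[OF assms] .
  then have "card {e \<in> edges H. w \<in> e} \<noteq> 0" using w by (simp add: vdegree_def)
  then have "{e \<in> edges H. w \<in> e} \<noteq> {}" by (metis card.empty)
  then obtain e where "e \<in> edges H" "w \<in> e" by auto
  \<comment> \<open>An edge at a vertex of degree 1 would be pendant; this supplies the d \<ge> 2 of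
    the lower bound.\<close>
  then have "?d \<noteq> 1" using np w by (auto simp: pendant_edge_def)
  with d0 have d: "2 \<le> ?d" by simp
  have "?d * n \<le> 2 * rwsat n H"
    using rwsat_lower_bound[OF assms(1) d min_nonzero_degree(3)[OF assms]] n by simp
  then have "real ?d * real n \<le> 2 * real (rwsat n H)"
    by (metis of_nat_le_iff of_nat_mult of_nat_numeral)
  then show "1 / 2 * real ?d * real n \<le> real (rwsat n H)" by simp
  have "rwsat n H \<le> ((threshold H + ?d) choose 2) + (n - (threshold H + ?d)) * ?d"
    using rwsat_upper_bound[OF assms(1) w, of ?d n] d n by simp
  then have "real (rwsat n H) \<le> real (((threshold H + ?d) choose 2) + (n - (threshold H + ?d)) * ?d)"
    by (simp only: of_nat_le_iff)
  also have "\<dots> = real ?d * (real n - real (threshold H) - real ?d) + real ((threshold H + ?d) choose 2)"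
  proof -
    have "real (n - (threshold H + ?d)) = real n - real (threshold H) - real ?d" using n by simp
    then show ?thesis by (simp only: of_nat_add of_nat_mult mult.commute add.commute)
  qed
  finally show "real (rwsat n H) \<le>
      real ?d * (real n - real (threshold H) - real ?d) + real ((threshold H + ?d) choose 2)" .
qed

end
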